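(* Let $(X,f_{1,\infty})$ be a nontrivial non-autonomous discrete system (that is, $X$ is not reduced to a single point). If $f_{1,\infty}$ is mixing, then $f_{1,\infty}$ is cofinitely sensitive.
   Context: $\mathbb{N}=\{1,2,3,\dots\}$, $\mathbb{Z}_+=\{0,1,2,\dots\}$. A non-autonomous discrete system (NDS) $(X,f_{1,\infty})$ consists of a metric space $(X,d)$ and a sequence $f_{1,\infty}=(f_n)_{n=1}^\infty$ of continuous maps $f_n:X\to X$. For $i,n\in\mathbb{N}$, $f_i^n:=f_{i+n-1}\circ\cdots\circ f_i$. Mixing: for any two non-empty open sets $U,V\subseteq X$ there is $N\in\mathbb{N}$ with $f_1^n(U)\cap V\neq\emptyset$ for all $n\ge N$. For a non-empty open set $U\subseteq X$ and $\delta>0$, $N_{f_{1,\infty}}(U,\delta)=\{n\in\mathbb{N}:\text{there exist }x,y\in U\text{ with }d(f_1^n(x),f_1^n(y))>\delta\}$. Cofinite: $A\subseteq\mathbb{Z}_+$ is cofinite if there is $N\in\mathbb{Z}_+$ such that $A$ contains all integers $n\ge N$. Cofinitely sensitive: there is $\delta>0$ such that $N_{f_{1,\infty}}(U,\delta)$ is cofinite for every non-empty open set $U\subseteq X$. *)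

theory Defs
  imports "HOL-Analysis.Analysis"
begin

text \<open>
  The metric space is the universe of a type of class \<open>metric_space\<close>. The maps are indexed
  by the positive integers; the value \<open>f 0\<close> is never used.
\<close>

definition nds :: "(nat \<Rightarrow> 'a::metric_space \<Rightarrow> 'a) \<Rightarrow> bool" where
  "nds f \<longleftrightarrow> (\<forall>n\<ge>1. continuous_on UNIV (f n))"

text \<open>\<open>nds_iter f i n\<close> is $f_{i+n-1} \circ \cdots \circ f_i$, a composition of \<open>n\<close> maps.\<close>

primrec nds_iter :: "(nat \<Rightarrow> 'a \<Rightarrow> 'a) \<Rightarrow> nat \<Rightarrow> nat \<Rightarrow> 'a \<Rightarrow> 'a" where
  "nds_iter f i 0 = id"
| "nds_iter f i (Suc n) = f (i + n) \<circ> nds_iter f i n"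

definition mixing :: "(nat \<Rightarrow> 'a::metric_space \<Rightarrow> 'a) \<Rightarrow> bool" where
  "mixing f \<longleftrightarrow> (\<forall>U V. open U \<and> U \<noteq> {} \<and> open V \<and> V \<noteq> {} \<longrightarrow>
     (\<exists>N\<ge>1. \<forall>n\<ge>N. nds_iter f 1 n ` U \<inter> V \<noteq> {}))"

definition sens_times :: "(nat \<Rightarrow> 'a::metric_space \<Rightarrow> 'a) \<Rightarrow> 'a set \<Rightarrow> real \<Rightarrow> nat set" where
  "sens_times f U \<delta> =
     {n. n \<ge> 1 \<and> (\<exists>x\<in>U. \<exists>y\<in>U. dist (nds_iter f 1 n x) (nds_iter f 1 n y) > \<delta>)}"

definition cofinite_nat :: "nat set \<Rightarrow> bool" where
  "cofinite_nat A \<longleftrightarrow> (\<exists>N. \<forall>n\<ge>N. n \<in> A)"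

definition cofinitely_sensitive :: "(nat \<Rightarrow> 'a::metric_space \<Rightarrow> 'a) \<Rightarrow> bool" where
  "cofinitely_sensitive f \<longleftrightarrow>
     (\<exists>\<delta>>0. \<forall>U. open U \<and> U \<noteq> {} \<longrightarrow> cofinite_nat (sens_times f U \<delta>))"

end

theory Submission
  imports Defs
begin

text \<open>Fix two distinct points a and b, and let \<delta> be a quarter of their distance. By
  mixing, the image of any non-empty open U meets both \<delta>-balls, around a and around b, at all
  large times. Points of these two balls are more than 2 \<delta> apart, so U is stretched beyond
  \<delta> at all those times. As \<delta> depends only on a and b, it serves every U.\<close>

theorem theorem6:
  fixes f :: "nat \<Rightarrow> 'a::metric_space \<Rightarrow> 'a"
  assumes "nds f"
    and "\<not> (\<exists>a. (UNIV :: 'a set) = {a})"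
    and "mixing f"
  shows "cofinitely_sensitive f"
proof -
  \<comment> \<open>A type is never empty, so a universe that is not a singleton has two distinct
    points.\<close>
  obtain a b :: 'a where "a \<noteq> b"
    using assms(2) by (metis UNIV_I UNIV_eq_I insertI1 singletonI)
  define \<delta> where "\<delta> = dist a b / 4"
  have "\<delta> > 0"
    using \<open>a \<noteq> b\<close> by (simp add: \<delta>_def)
  have hit: "\<exists>N\<ge>1. \<forall>n\<ge>N. nds_iter f 1 n ` U \<inter> ball c \<delta> \<noteq> {}"
    if "open U" "U \<noteq> {}" for U c
    using assms(3) that \<open>\<delta> > 0\<close> unfolding mixing_def
    by (metis centre_in_ball empty_iff open_ball)
  have "cofinite_nat (sens_times f U \<delta>)" if U: "open U" "U \<noteq> {}" for U
  proof -
    \<comment> \<open>\<open>sens_times\<close> admits only positive times; \<open>N \<ge> 1\<close>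
      ensures this for all \<open>n \<ge> max N M\<close>.\<close>
    obtain N M where "N \<ge> 1"
      and N: "\<And>n. n \<ge> N \<Longrightarrow> nds_iter f 1 n ` U \<inter> ball a \<delta> \<noteq> {}"
      and M: "\<And>n. n \<ge> M \<Longrightarrow> nds_iter f 1 n ` U \<inter> ball b \<delta> \<noteq> {}"
      using hit[OF U, of a] hit[OF U, of b] by blast
    have "n \<in> sens_times f U \<delta>" if n: "n \<ge> max N M" for n
    proof -
      obtain x y where "x \<in> U" "y \<in> U"
        and x: "dist a (nds_iter f 1 n x) < \<delta>" and y: "dist b (nds_iter f 1 n y) < \<delta>"
        using N[of n] M[of n] n by (auto simp: disjoint_iff)
      have "dist a b \<le> dist a (nds_iter f 1 n x)
          + dist (nds_iter f 1 n x) (nds_iter f 1 n y) + dist b (nds_iter f 1 n y)"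
        by (metis add_mono_thms_linordered_semiring(3) dist_commute dist_triangle order_trans)
      \<comment> \<open>The middle distance exceeds 4 \<delta> - \<delta> - \<delta> = 2
        \<delta>.\<close>
      then have "dist (nds_iter f 1 n x) (nds_iter f 1 n y) > \<delta>"
        using x y \<open>\<delta> > 0\<close> unfolding \<delta>_def by argo
      then show ?thesis
        using \<open>x \<in> U\<close> \<open>y \<in> U\<close> \<open>N \<ge> 1\<close> n unfolding sens_times_def by auto
    qed
    then show ?thesis
      unfolding cofinite_nat_def by blast
  qed
  then show ?thesis
    using \<open>\<delta> > 0\<close> unfolding cofinitely_sensitive_def by blast
qed

end
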